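(* Let $a\ge 0$ be an integer. Suppose that all of the numbers $$\frac{\zeta(2a+3)}{\pi^{2a+3}},\ \frac{\zeta(2a+5)}{\pi^{2a+5}},\ \ldots,\ \frac{\zeta(4a+3)}{\pi^{4a+3}}$$ (that is, $\zeta(2k+1)/\pi^{2k+1}$ for $a+1\le k\le 2a+1$) are rational, and let $q_a$ denote their common denominator. Then $q_a\ge (2a+2)!$.
   Context: Here $\zeta$ is the Riemann zeta function. The common denominator of finitely many rational numbers is the least positive integer $q$ such that $q$ times each of them is an integer. *)

theory Defs
  imports "HOL-Analysis.Analysis"
begin

text \<open>
  The Riemann zeta function on real arguments \<open>s > 1\<close>, where its Dirichlet series converges.
  No value is intended for \<open>s \<le> 1\<close>: there the series diverges, and the definition
  does not give the analytic continuation.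
\<close>

definition riemann_zeta :: "real \<Rightarrow> real" where
  "riemann_zeta s = (\<Sum>n. 1 / real (Suc n) powr s)"

text \<open>Meaningful only for finite sets of rational numbers, where the \<open>LEAST\<close> is attained.\<close>

definition common_denominator :: "real set \<Rightarrow> nat" where
  "common_denominator A = (LEAST q. q > 0 \<and> (\<forall>x\<in>A. real q * x \<in> \<int>))"

end

(* Let n = 2a + 2, Q(x) = (x (1 - x))^n and I = \<integral> Q'(x) cot(\<pi> x) dx over [0, 1]. Expanding
   the cotangent as the formal sine series \<Sum> 2 sin(2 \<pi> m x) and integrating by parts gives
     I = \<Sum> (-1)^k 4 Q^(2k+1)(0) / 2^(2k+1) * \<zeta>(2k+1) / \<pi>^(2k+1),
   where only a + 1 \<le> k \<le> 2a + 1 contribute, and each Q^(2k+1)(0) is divisible by n!. So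
   q 2^(4a+1) I / n! is an integer. It is positive, and \<bar>x (1 - x) cot(\<pi> x)\<bar> \<le> 1/\<pi> yields
   2^(4a+1) I \<le> 2/\<pi> < 1, whence q \<ge> n!.
   The sine series diverges, so it is summed by Cesaro means: these tend to the cotangent and are
   bounded by twice its absolute value, and dominated convergence applies. *)

theory Submission
  imports Defs
begin

section \<open>Two-sided bounds for the cotangent on (0, 1)\<close>

lemma mult_cos_le_sin:
  fixes t :: real
  assumes "0 \<le> t" "t \<le> pi"
  shows "t * cos t \<le> sin t"
proof -
  \<comment> \<open>The difference vanishes at 0 and its derivative \<open>s * sin s\<close> is
    nonnegative up to pi.\<close>
  have "(\<lambda>t. sin t - t * cos t) 0 \<le> (\<lambda>t. sin t - t * cos t) t"
  proof (rule DERIV_nonneg_imp_nondecreasing[OF assms(1)])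
    fix s :: real assume "0 \<le> s" "s \<le> t"
    have "((\<lambda>t. sin t - t * cos t) has_real_derivative s * sin s) (at s)"
      by (auto intro!: derivative_eq_intros)
    moreover have "s * sin s \<ge> 0"
      using \<open>0 \<le> s\<close> \<open>s \<le> t\<close> assms by (intro mult_nonneg_nonneg sin_ge_zero) auto
    ultimately show "\<exists>y. ((\<lambda>t. sin t - t * cos t) has_real_derivative y) (at s) \<and> 0 \<le> y"
      by blast
  qed
  then show ?thesis by simp
qed

lemma cot_reflect: "cot (pi * (1 - x)) = - cot (pi * x)" for x :: real
  by (simp add: cot_def right_diff_distrib)

text \<open>Both bounds are instances of t cos t <= sin t: the first at t = pi/2 - pi x, where sine
  and cosine swap, the second at t = pi x.\<close>

lemma cot_bounds:
  fixes x :: real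
  assumes "0 < x" "x \<le> 1/2"
  shows "cot (pi * x) \<ge> pi / 2 * (1 - 2 * x)" "x * cot (pi * x) \<le> 1 / pi"
proof -
  have px: "0 < pi * x" "pi * x \<le> pi / 2" using assms by auto
  have s: "sin (pi * x) > 0" using px by (intro sin_gt_zero) auto
  have "(pi / 2 - pi * x) * cos (pi / 2 - pi * x) \<le> sin (pi / 2 - pi * x)"
    using px pi_gt_zero by (intro mult_cos_le_sin) linarith+
  then have "pi / 2 * (1 - 2 * x) * sin (pi * x) \<le> cos (pi * x)"
    by (simp add: cos_diff sin_diff algebra_simps)
  then show "cot (pi * x) \<ge> pi / 2 * (1 - 2 * x)"
    using s by (simp add: cot_def field_simps)
  have "pi * x * cos (pi * x) \<le> sin (pi * x)"
    using px by (intro mult_cos_le_sin) auto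
  then show "x * cot (pi * x) \<le> 1 / pi"
    using s by (simp add: cot_def field_simps)
qed

text \<open>The factor x (1 - x) cancels the simple poles at 0 and 1. Since the cotangent is odd
  about 1/2, the left half of the interval suffices.\<close>

lemma cot_upper:
  fixes x :: real
  assumes "0 < x" "x < 1"
  shows "x * (1 - x) * \<bar>cot (pi * x)\<bar> \<le> 1 / pi"
proof -
  have *: "y * (1 - y) * \<bar>cot (pi * y)\<bar> \<le> 1 / pi" if "0 < y" "y \<le> 1/2" for y :: real
  proof -
    have "0 \<le> pi / 2 * (1 - 2 * y)" using that by simp
    then have c: "cot (pi * y) \<ge> 0" using cot_bounds(1)[OF that] by linarith
    have "(1 - y) * (y * cot (pi * y)) \<le> 1 * (1 / pi)"
      using cot_bounds(2)[OF that] that c by (intro mult_mono) auto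
    then show ?thesis using c by (simp add: mult_ac)
  qed
  show ?thesis
  proof (cases "x \<le> 1/2")
    case False
    then show ?thesis using *[of "1 - x"] assms cot_reflect[of x] by (simp add: mult_ac)
  qed (use * assms in auto)
qed

text \<open>Both factors on the left are odd about 1/2, so their product is even and again the left
  half suffices. As 1 - 2x is a factor of Q', this is what makes the cotangent integral
  positive.\<close>

lemma cot_lower:
  fixes x :: real
  assumes "0 < x" "x < 1"
  shows "(1 - 2 * x) * cot (pi * x) \<ge> pi / 2 * (1 - 2 * x)\<^sup>2"
proof -
  have *: "(1 - 2 * y) * cot (pi * y) \<ge> pi / 2 * (1 - 2 * y)\<^sup>2"
    if "0 < y" "y \<le> 1/2" for y :: real
    using mult_left_mono[OF cot_bounds(1)[OF that], of "1 - 2 * y"] that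
    by (simp add: power2_eq_square mult_ac)
  show ?thesis
  proof (cases "x \<le> 1/2")
    case False
    have "(1 - 2 * (1 - x))\<^sup>2 = (1 - 2 * x)\<^sup>2" by (simp add: power2_eq_square algebra_simps)
    moreover have "(1 - 2 * (1 - x)) * cot (pi * (1 - x)) = (1 - 2 * x) * cot (pi * x)"
      unfolding cot_reflect by (simp add: algebra_simps)
    ultimately show ?thesis using *[of "1 - x"] assms False by simp
  qed (use * assms in auto)
qed

section \<open>Cesaro summation of the sine series of the cotangent\<close>

lemma abs_sin_nat_mult_le: "\<bar>sin (real n * t)\<bar> \<le> real n * \<bar>sin t\<bar>"
proof (induction n)
  case (Suc n)
  have "\<bar>sin (real (Suc n) * t)\<bar> = \<bar>sin (real n * t) * cos t + cos (real n * t) * sin t\<bar>"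
    using sin_add[of "real n * t" t] by (simp add: algebra_simps)
  also have "\<dots> \<le> \<bar>sin (real n * t)\<bar> * \<bar>cos t\<bar> + \<bar>cos (real n * t)\<bar> * \<bar>sin t\<bar>"
    using abs_triangle_ineq by (simp flip: abs_mult)
  also have "\<dots> \<le> \<bar>sin (real n * t)\<bar> * 1 + 1 * \<bar>sin t\<bar>"
    by (intro add_mono mult_mono) auto
  finally show ?case using Suc by (simp add: algebra_simps)
qed simp

text \<open>Twice the conjugate Fejer kernel at 2t: the mean of the partial sums of lengths 0 to N -
  1. Division by zero makes it 0 for N = 0.\<close>

definition conj_fejer :: "nat \<Rightarrow> real \<Rightarrow> real" where
  "conj_fejer N t = (\<Sum>M<N. \<Sum>m<M. 2 * sin (2 * real (Suc m) * t)) / real N"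

text \<open>Multiplying by sin t turns each term into a difference of consecutive cosines, and the
  sum telescopes. The remaining cosine oscillates with M, hence the averaging.\<close>

lemma conj_dirichlet_closed_form:
  "sin t * (\<Sum>m<M. 2 * sin (2 * real (Suc m) * t)) = cos t - cos ((2 * real M + 1) * t)"
proof (induction M)
  case (Suc M)
  have "cos ((2 * real M + 1) * t) - cos ((2 * real (Suc M) + 1) * t)
      = 2 * sin t * sin (2 * real (Suc M) * t)"
    using cos_diff_cos[of "(2 * real M + 1) * t" "(2 * real (Suc M) + 1) * t"]
    by (simp add: algebra_simps add_divide_distrib)
  with Suc show ?case by (simp add: algebra_simps)
qed simp

text \<open>A second factor sin t makes the leftover cosines telescope as well, now into differences
  of sines.\<close>

lemma sum_conj_dirichlet_closed_form:
  "(sin t)\<^sup>2 * (\<Sum>M<N. \<Sum>m<M. 2 * sin (2 * real (Suc m) * t)) =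
     real N * (sin t * cos t) - sin (real N * (2 * t)) / 2"
proof (induction N)
  case (Suc N)
  have "sin (real (Suc N) * (2 * t)) - sin (real N * (2 * t)) = 2 * (sin t * cos ((2 * real N + 1) * t))"
    using sin_diff_sin[of "real (Suc N) * (2 * t)" "real N * (2 * t)"]
    by (simp add: algebra_simps add_divide_distrib)
  moreover have "(sin t)\<^sup>2 * (\<Sum>m<N. 2 * sin (2 * real (Suc m) * t)) =
      sin t * cos t - sin t * cos ((2 * real N + 1) * t)"
    using arg_cong[OF conj_dirichlet_closed_form[of t N], of "\<lambda>z. sin t * z"]
    by (simp only: power2_eq_square right_diff_distrib mult.assoc)
  ultimately show ?case
    unfolding sum.lessThan_Suc[of _ N] distrib_left Suc of_nat_Suc[of N] distrib_right
    by linarith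
qed simp

lemma conj_fejer_closed_form:
  assumes "sin t \<noteq> 0" "N > 0"
  shows "conj_fejer N t = cot t - sin (real N * (2 * t)) / (2 * real N * (sin t)\<^sup>2)"
proof -
  have "conj_fejer N t =
      (real N * (sin t * cos t) - sin (real N * (2 * t)) / 2) / ((sin t)\<^sup>2 * real N)"
    unfolding sum_conj_dirichlet_closed_form[symmetric] conj_fejer_def using assms by simp
  also have "\<dots> = cot t - sin (real N * (2 * t)) / (2 * real N * (sin t)\<^sup>2)"
    using assms by (simp add: cot_def field_simps power2_eq_square)
  finally show ?thesis .
qed

text \<open>By |sin(2Nt)| <= N |sin(2t)|, the correction in the closed form is at most |cot t|. The
  bound is uniform in N, as dominated convergence requires.\<close>

lemma abs_conj_fejer_le:
  assumes "sin t \<noteq> 0"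
  shows "\<bar>conj_fejer N t\<bar> \<le> 2 * \<bar>cot t\<bar>"
proof (cases "N = 0")
  case False
  have "\<bar>sin (real N * (2 * t))\<bar> \<le> real N * \<bar>sin (2 * t)\<bar>"
    by (rule abs_sin_nat_mult_le)
  then have "\<bar>sin (real N * (2 * t)) / (2 * real N * (sin t)\<^sup>2)\<bar>
      \<le> (real N * \<bar>sin (2 * t)\<bar>) / (2 * real N * (sin t)\<^sup>2)"
    by (subst abs_divide, subst abs_of_nonneg[of "2 * real N * (sin t)\<^sup>2"])
       (simp, intro divide_right_mono, simp_all)
  also have "\<dots> = (\<bar>sin t\<bar> * \<bar>cos t\<bar>) / (\<bar>sin t\<bar> * \<bar>sin t\<bar>)"
    using False by (simp add: sin_double abs_mult power2_eq_square)
  also have "\<dots> = \<bar>cot t\<bar>"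
    unfolding cot_def abs_divide using assms by (intro mult_divide_mult_cancel_left) simp
  finally show ?thesis
    using conj_fejer_closed_form[OF assms, of N] False by linarith
qed (simp add: conj_fejer_def)

lemma conj_fejer_tendsto_cot:
  assumes "sin t \<noteq> 0"
  shows "(\<lambda>N. conj_fejer N t) \<longlonglongrightarrow> cot t"
proof -
  have "(\<lambda>N. sin (real N * (2 * t)) * inverse (real N)) \<longlonglongrightarrow> 0"
  proof (rule Lim_null_comparison)
    show "\<forall>\<^sub>F N in sequentially. norm (sin (real N * (2 * t)) * inverse (real N)) \<le> inverse (real N)"
      by (intro always_eventually allI) (simp add: abs_mult mult_left_le_one_le)
  qed (rule lim_inverse_n)
  then have "(\<lambda>N. cot t - (sin (real N * (2 * t)) * inverse (real N)) / (2 * (sin t)\<^sup>2))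
      \<longlonglongrightarrow> cot t - 0 / (2 * (sin t)\<^sup>2)"
    using assms by (intro tendsto_intros) auto
  then have "(\<lambda>N. cot t - (sin (real N * (2 * t)) * inverse (real N)) / (2 * (sin t)\<^sup>2))
      \<longlonglongrightarrow> cot t" by simp
  moreover have "\<forall>\<^sub>F N in sequentially.
      cot t - (sin (real N * (2 * t)) * inverse (real N)) / (2 * (sin t)\<^sup>2) = conj_fejer N t"
    using eventually_gt_at_top[of 0]
    by eventually_elim (use conj_fejer_closed_form[OF assms] in \<open>simp add: field_simps\<close>)
  ultimately show ?thesis by (rule Lim_transform_eventually)
qed

text \<open>The first \<open>n0\<close> deviations have a fixed total, which division by N makes
  negligible; each later one is below e/2. Applied to the termwise integrals, this identifies the
  limit of the averaged integrals.\<close>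

lemma cesaro_mean_tendsto:
  fixes T :: "nat \<Rightarrow> real"
  assumes "T \<longlonglongrightarrow> L"
  shows "(\<lambda>N. (\<Sum>M<N. T M) / real N) \<longlonglongrightarrow> L"
proof (rule LIMSEQ_I)
  fix e :: real assume e: "e > 0"
  obtain n0 where n0: "\<And>n. n \<ge> n0 \<Longrightarrow> \<bar>T n - L\<bar> < e / 2"
    using LIMSEQ_D[OF assms, of "e/2"] e by auto
  define C where "C = (\<Sum>M<n0. \<bar>T M - L\<bar>)"
  obtain n1 :: nat where n1: "2 * C / e < real n1" using reals_Archimedean2 by blast
  show "\<exists>no. \<forall>N\<ge>no. norm ((\<Sum>M<N. T M) / real N - L) < e"
  proof (intro exI allI impI)
    fix N assume N: "N \<ge> max (max n0 n1) 1"
    have "2 * C / e < real N" using n1 N by simp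
    then have CN: "C < e / 2 * real N" using e by (simp add: field_simps)
    have "{..<N} = {..<n0} \<union> {n0..<N}" using N by auto
    then have "(\<Sum>M<N. \<bar>T M - L\<bar>) = C + (\<Sum>M=n0..<N. \<bar>T M - L\<bar>)"
      unfolding C_def by (simp add: sum.union_disjoint ivl_disj_int)
    also have "(\<Sum>M=n0..<N. \<bar>T M - L\<bar>) \<le> real (card {n0..<N}) * (e / 2)"
      by (intro sum_bounded_above) (use n0 in \<open>auto intro: less_imp_le\<close>)
    also have "\<dots> \<le> real N * (e / 2)" using e by (intro mult_right_mono) auto
    finally have "(\<Sum>M<N. \<bar>T M - L\<bar>) < real N * e" using CN by (simp add: algebra_simps)
    moreover have "\<bar>\<Sum>M<N. (T M - L)\<bar> \<le> (\<Sum>M<N. \<bar>T M - L\<bar>)" by (rule sum_abs)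
    ultimately have "\<bar>(\<Sum>M<N. T M) - real N * L\<bar> < real N * e" by (simp add: sum_subtractf)
    moreover have "(\<Sum>M<N. T M) / real N - L = ((\<Sum>M<N. T M) - real N * L) / real N"
      using N by (simp add: field_simps)
    ultimately show "norm ((\<Sum>M<N. T M) / real N - L) < e"
      using N by (simp add: field_simps)
  qed
qed

section \<open>Integrals of polynomials against sines\<close>

lemma has_integral_poly_sin:
  fixes p :: "real poly" and w :: real
  assumes deg: "degree p < 2 * K" and w: "w \<noteq> 0" and per: "sin w = 0" "cos w = 1"
  shows "((\<lambda>x. poly p x * sin (w * x)) has_integral
     (\<Sum>k<K. (-1) ^ k * (poly ((pderiv ^^ (2 * k)) p) 0 - poly ((pderiv ^^ (2 * k)) p) 1)
        / w ^ (2 * k + 1))) {0..1}"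
proof -
  define D where "D j = poly ((pderiv ^^ j) p)" for j
  define c where "c = inverse w"
  have cw: "w * (c * z) = z" for z using w by (simp add: c_def)
  \<comment> \<open>The antiderivative produced by integrating by parts 2K times. Its sine terms
    vanish at both endpoints, so only the cosine terms reach the result. Keeping
    \<open>c * c ^ (2 * k + 1)\<close> unmerged lets each summand be differentiated with a generic A
    for the power.\<close>
  define G where "G x = (\<Sum>k<K. (-1) ^ k * (D (2 * k + 1) x * sin (w * x) * (c * c ^ (2 * k + 1))
      - D (2 * k) x * cos (w * x) * c ^ (2 * k + 1)))" for x
  have D: "(D j has_real_derivative D (Suc j) x) (at x)" for j x
    unfolding D_def by (simp add: poly_DERIV)
  \<comment> \<open>After differentiation the cosine terms cancel, and the sine coefficients
    telescope to \<open>D 0\<close> and a term in \<open>D (2 * K)\<close>, which vanishes by the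
    degree bound.\<close>
  have tele: "(\<Sum>k<n. (-1) ^ k * (D (2 * k + 2) x * c ^ (2 * k + 2) + D (2 * k) x * c ^ (2 * k)))
     = D 0 x - (-1) ^ n * D (2 * n) x * c ^ (2 * n)" for n x
    by (induction n) (simp_all add: algebra_simps)
  have zero: "D (2 * K) x = 0" for x
  proof -
    have "coeff ((pderiv ^^ (2 * K)) p) n = 0" for n
      unfolding coeff_higher_pderiv using deg by (simp add: coeff_eq_0)
    then have "(pderiv ^^ (2 * K)) p = 0" by (intro poly_eqI) simp
    then show ?thesis by (simp add: D_def)
  qed
  have G': "(G has_real_derivative D 0 x * sin (w * x)) (at x)" for x
  proof -
    have "((\<lambda>x. (-1) ^ k * (D (2 * k + 1) x * sin (w * x) * (c * A) - D (2 * k) x * cos (w * x) * A))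
      has_real_derivative (-1) ^ k * (D (2 * k + 2) x * (c * A) + D (2 * k) x * (w * A)) * sin (w * x)) (at x)"
      for k and A :: real
      by (rule derivative_eq_intros D refl)+ (simp add: algebra_simps cw c_def w)
    then have "(G has_real_derivative (\<Sum>k<K. (-1) ^ k * (D (2 * k + 2) x * (c * c ^ (2 * k + 1))
        + D (2 * k) x * (w * c ^ (2 * k + 1))) * sin (w * x))) (at x)"
      unfolding G_def by (intro DERIV_sum)
    also have "(\<Sum>k<K. (-1) ^ k * (D (2 * k + 2) x * (c * c ^ (2 * k + 1))
        + D (2 * k) x * (w * c ^ (2 * k + 1))) * sin (w * x))
      = (\<Sum>k<K. (-1) ^ k * (D (2 * k + 2) x * c ^ (2 * k + 2) + D (2 * k) x * c ^ (2 * k)))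
        * sin (w * x)"
      unfolding sum_distrib_right by (intro sum.cong refl) (simp add: cw)
    also have "\<dots> = D 0 x * sin (w * x)" unfolding tele zero by simp
    finally show ?thesis .
  qed
  have "((\<lambda>x. D 0 x * sin (w * x)) has_integral (G 1 - G 0)) {0..1}"
    by (intro fundamental_theorem_of_calculus)
      (use G' in \<open>auto simp: has_real_derivative_iff_has_vector_derivative[symmetric]
         intro: has_field_derivative_at_within\<close>)
  also have "G 1 - G 0 = (\<Sum>k<K. (-1) ^ k * (D (2 * k) 0 - D (2 * k) 1) / w ^ (2 * k + 1))"
    unfolding G_def sum_subtractf[symmetric] using per
    by (intro sum.cong refl) (simp add: c_def diff_divide_distrib power_inverse divide_inverse algebra_simps)
  finally show ?thesis by (simp add: D_def)
qed

section \<open>Derivatives of Q = (x (1 - x))^n at the endpoints\<close>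

lemma pderiv_bump:
  "poly (pderiv ([:0, 1, -1:] ^ n)) x = real n * (x * (1 - x)) ^ (n - 1) * (1 - 2 * x)"
proof (cases n)
  case (Suc l)
  show ?thesis unfolding Suc pderiv_power_Suc by (simp add: pderiv_pCons algebra_simps)
qed simp

lemma coeff_bump:
  "coeff ([:0, 1, -1:] ^ n :: real poly) j = (if n \<le> j then coeff ([:1, -1:] ^ n) (j - n) else 0)"
proof -
  have "[:0, 1, -1:] = monom 1 1 * [:1, -1 :: real:]" by (simp add: monom_altdef)
  then have "[:0, 1, -1:] ^ n = monom 1 n * [:1, -1 :: real:] ^ n"
    by (simp only: power_mult_distrib monom_power) simp
  then show ?thesis by (simp add: coeff_monom_mult)
qed

lemma coeff_one_minus_x_power_Ints: "coeff ([:1, -1 :: real:] ^ n) j \<in> \<int>"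
  by (induction n arbitrary: j) (auto simp: coeff_pCons split: nat.split intro!: Ints_diff)

text \<open>The j-th derivative at 0 is j! times the j-th coefficient of Q. That coefficient is an
  integer, and it is 0 for j < n, while n! divides j! for j \<ge> n.\<close>

lemma higher_pderiv_bump_0: "poly ((pderiv ^^ j) ([:0, 1, -1:] ^ n)) 0 / fact n \<in> (\<int> :: real set)"
proof (cases "n \<le> j")
  case True
  have "poly ((pderiv ^^ j) ([:0, 1, -1:] ^ n)) 0 / fact n
      = fact j / fact n * coeff ([:1, -1 :: real:] ^ n) (j - n)"
    using True unfolding poly_0_coeff_0 coeff_higher_pderiv coeff_bump
    by (simp add: pochhammer_fact)
  also obtain i :: nat where "fact j = fact n * i" using fact_dvd[OF True] by (elim dvdE)
  then have "fact j / fact n = real i" by (metis nonzero_mult_div_cancel_left fact_nonzero of_nat_fact of_nat_mult)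
  then have "fact j / fact n * coeff ([:1, -1 :: real:] ^ n) (j - n) \<in> \<int>"
    by (simp add: coeff_one_minus_x_power_Ints)
  finally show ?thesis .
qed (simp add: poly_0_coeff_0 coeff_higher_pderiv coeff_bump)

text \<open>Q has a zero of order n at 0. This removes the low terms of the expansion, among them k
  = 0, whose series would be harmonic.\<close>

lemma higher_pderiv_bump_0_eq_0:
  "j < n \<Longrightarrow> poly ((pderiv ^^ j) ([:0, 1, -1 :: real:] ^ n)) 0 = 0"
  by (simp add: poly_0_coeff_0 coeff_higher_pderiv coeff_bump)

text \<open>Q is invariant under x -> 1 - x, and each differentiation contributes one sign by the
  chain rule. The symmetry is shown as a polynomial identity, so that it can be differentiated in
  the induction.\<close>

lemma higher_pderiv_bump_1:
  "poly ((pderiv ^^ j) ([:0, 1, -1 :: real:] ^ n)) 1 =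
     (-1) ^ j * poly ((pderiv ^^ j) ([:0, 1, -1:] ^ n)) 0"
proof -
  let ?D = "\<lambda>j. (pderiv ^^ j) ([:0, 1, -1 :: real:] ^ n)"
  have "pcompose (?D j) [:1, -1:] = smult ((-1) ^ j) (?D j)"
  proof (induction j)
    case 0
    have "pcompose [:0, 1, -1 :: real:] [:1, -1:] = [:0, 1, -1:]"
      by (simp add: pcompose_pCons)
    then show ?case by (induction n) (simp_all add: pcompose_mult pcompose_1 del: mult_pCons_left)
  next
    case (Suc j)
    have "pderiv (pcompose (?D j) [:1, -1:]) = pcompose (?D (Suc j)) [:1, -1:] * [:-1:]"
      by (simp add: pderiv_pcompose pderiv_pCons)
    then have "- pcompose (?D (Suc j)) [:1, -1:] = smult ((-1) ^ j) (?D (Suc j))"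
      unfolding Suc by (simp add: pderiv_smult)
    from arg_cong[OF this, of uminus] show ?case by (simp del: funpow.simps)
  qed
  then have "poly (pcompose (?D j) [:1, -1:]) 0 = poly (smult ((-1) ^ j) (?D j)) 0" by (rule arg_cong)
  then show ?thesis by (simp add: poly_pcompose)
qed

section \<open>The zeta series and the cotangent integral\<close>

lemma riemann_zeta_sums:
  assumes "k > 0"
  shows "(\<lambda>m. 1 / real (Suc m) ^ (2 * k + 1)) sums riemann_zeta (real (2 * k + 1))"
proof -
  have eq: "1 / real (Suc m) powr real (2 * k + 1) = 1 / real (Suc m) ^ (2 * k + 1)" for m
    by (simp only: powr_realpow of_nat_0_less_iff zero_less_Suc)
  have "summable (\<lambda>m. inverse (real (Suc m) ^ (2 * k + 1)))"
    using inverse_power_summable[of "2 * k + 1", where 'a = real] assms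
    by (subst summable_Suc_iff) auto
  then show ?thesis
    unfolding riemann_zeta_def eq by (simp add: divide_inverse summable_sums)
qed

text \<open>Without the absolute value the integrand is the derivative of (x (1 - x))^(l+1) / (l+1).
  Splitting at 1/2, where 1 - 2x changes sign, gives two equal halves. The value controls the size
  of the cotangent integral.\<close>

lemma has_integral_power_mult_abs:
  fixes l :: nat
  shows "((\<lambda>x::real. (x * (1 - x)) ^ l * \<bar>1 - 2 * x\<bar>) has_integral 2 / (real (Suc l) * 4 ^ Suc l)) {0..1}"
proof -
  let ?F = "\<lambda>x::real. (x * (1 - x)) ^ Suc l / real (Suc l)"
  have D: "(?F has_vector_derivative (x * (1 - x)) ^ l * (1 - 2 * x)) (at x within S)" for x S
  proof -
    have "((\<lambda>x. x * (1 - x)) has_real_derivative 1 - 2 * x) (at x within S)"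
      by (auto intro!: derivative_eq_intros)
    from DERIV_power[OF this, of "Suc l"]
    have "((\<lambda>x. (x * (1 - x)) ^ Suc l) has_real_derivative
        real (Suc l) * ((x * (1 - x)) ^ l * (1 - 2 * x))) (at x within S)"
      by (simp add: mult_ac)
    from DERIV_cdivide[OF this, of "real (Suc l)"] show ?thesis
      unfolding has_real_derivative_iff_has_vector_derivative[symmetric] by simp
  qed
  have F: "((\<lambda>x. (x * (1 - x)) ^ l * (1 - 2 * x)) has_integral ?F d - ?F c) {c..d}"
    if "c \<le> d" for c d
    using that D by (intro fundamental_theorem_of_calculus) auto
  have "((\<lambda>x. (x * (1 - x)) ^ l * \<bar>1 - 2 * x\<bar>) has_integral ?F (1/2) - ?F 0) {0..1/2}"
    by (rule has_integral_eq[OF _ F]) auto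
  moreover have "((\<lambda>x. (x * (1 - x)) ^ l * \<bar>1 - 2 * x\<bar>) has_integral - (?F 1 - ?F (1/2))) {1/2..1}"
    by (rule has_integral_eq[OF _ has_integral_neg[OF F]]) (auto simp: abs_if algebra_simps)
  ultimately have "((\<lambda>x. (x * (1 - x)) ^ l * \<bar>1 - 2 * x\<bar>) has_integral
      (?F (1/2) - ?F 0) + - (?F 1 - ?F (1/2))) {0..1}"
    by (intro has_integral_combine[of 0 "1/2" 1]) auto
  also have "(?F (1/2) - ?F 0) + - (?F 1 - ?F (1/2)) = 2 / (real (Suc l) * 4 ^ Suc l)"
    by (simp add: power_divide field_simps)
  finally show ?thesis .
qed

text \<open>Even derivatives of Q' are odd derivatives of Q, which take opposite values at 0 and 1.
  The boundary difference therefore doubles, and with the 2 before the sine this yields the factor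
  4.\<close>

lemma has_integral_pderiv_bump_sin:
  assumes "n \<ge> 2" "m > 0"
  shows "((\<lambda>x. poly (pderiv ([:0, 1, -1:] ^ n)) x * (2 * sin (2 * real m * (pi * x)))) has_integral
    (\<Sum>k<n. (-1) ^ k * 4 * poly ((pderiv ^^ (2 * k + 1)) ([:0, 1, -1:] ^ n)) 0
       / (2 * pi * real m) ^ (2 * k + 1))) {0..1}"
proof -
  let ?Q = "[:0, 1, -1:] ^ n :: real poly"
  let ?w = "2 * pi * real m"
  have "degree (pderiv ?Q) < 2 * n"
    using assms by (simp add: degree_pderiv degree_power_eq)
  moreover have "sin ?w = 0" "cos ?w = 1"
    using sin_npi2[of "2 * m"] cos_npi2[of "2 * m"] by (simp_all add: mult_ac)
  ultimately have "((\<lambda>x. 2 * (poly (pderiv ?Q) x * sin (?w * x))) has_integral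
      2 * (\<Sum>k<n. (-1) ^ k * (poly ((pderiv ^^ (2 * k)) (pderiv ?Q)) 0
        - poly ((pderiv ^^ (2 * k)) (pderiv ?Q)) 1) / ?w ^ (2 * k + 1))) {0..1}"
    using assms by (intro has_integral_mult_right has_integral_poly_sin) auto
  moreover have "(pderiv ^^ (2 * k)) (pderiv ?Q) = (pderiv ^^ (2 * k + 1)) ?Q" for k
    by (simp add: funpow_swap1)
  ultimately have "((\<lambda>x. 2 * (poly (pderiv ?Q) x * sin (?w * x))) has_integral
      2 * (\<Sum>k<n. (-1) ^ k * (2 * poly ((pderiv ^^ (2 * k + 1)) ?Q) 0) / ?w ^ (2 * k + 1))) {0..1}"
    by (simp only: higher_pderiv_bump_1) simp
  then show ?thesis
    by (simp add: sum_distrib_left mult_ac)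
qed

text \<open>Dominated convergence along the Cesaro means: the integrands tend to Q' times the
  cotangent, and the integrals are Cesaro means of the partial sums of \<open>T\<close>, hence tend
  to \<open>L\<close>.\<close>

lemma bump_cot_has_integral:
  fixes T :: "nat \<Rightarrow> real"
  assumes n: "n \<ge> 2"
    and T: "\<And>m. ((\<lambda>x. poly (pderiv ([:0, 1, -1:] ^ n)) x * (2 * sin (2 * real (Suc m) * (pi * x))))
              has_integral T m) {0..1}"
    and L: "T sums L"
  shows "((\<lambda>x. poly (pderiv ([:0, 1, -1:] ^ n)) x * cot (pi * x)) has_integral L) {0..1}"
proof -
  let ?p = "poly (pderiv ([:0, 1, -1 :: real:] ^ n))"
  obtain l where l: "n = Suc (Suc l)" using n by (metis Suc_le_D numeral_2_eq_2 le_Suc_ex add_Suc)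
  \<comment> \<open>Q' vanishes at both endpoints, so the integrand is 0 there whatever default
    value \<open>cot\<close> takes at a pole.\<close>
  have p0: "?p x = 0" if "x = 0 \<or> x = 1" for x
    unfolding pderiv_bump l using that by auto
  have s: "sin (pi * x) \<noteq> 0" if "0 < x" "x < 1" for x
    using that by (intro less_imp_neq[symmetric] sin_gt_zero) auto
  show ?thesis
  proof (rule has_integral_dominated_convergence)
    fix N
    have "((\<lambda>x. (\<Sum>M<N. \<Sum>m<M. ?p x * (2 * sin (2 * real (Suc m) * (pi * x)))) / real N)
       has_integral (\<Sum>M<N. \<Sum>m<M. T m) / real N) {0..1}"
      by (intro has_integral_divide has_integral_sum T) auto
    then show "((\<lambda>x. ?p x * conj_fejer N (pi * x)) has_integral (\<Sum>M<N. \<Sum>m<M. T m) / real N) {0..1}"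
      by (simp only: conj_fejer_def sum_distrib_left times_divide_eq_right)
  next
    show "(\<lambda>N. (\<Sum>M<N. \<Sum>m<M. T m) / real N) \<longlonglongrightarrow> L"
      using L unfolding sums_def by (rule cesaro_mean_tendsto)
  next
    \<comment> \<open>In the majorant, n comes from Q', 2 from the kernel bound, and 1/pi from
      spending one factor x (1 - x) of Q' on the cotangent; the power l = n - 2 remains.\<close>
    show "(\<lambda>x. 2 * real n / pi * ((x * (1 - x)) ^ l * \<bar>1 - 2 * x\<bar>)) integrable_on {0..1}"
      by (intro integrable_continuous_real continuous_intros)
  next
    show "\<forall>x\<in>{0..1}. norm (?p x * conj_fejer N (pi * x))
        \<le> 2 * real n / pi * ((x * (1 - x)) ^ l * \<bar>1 - 2 * x\<bar>)" for N
    proof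
      fix x :: real assume x: "x \<in> {0..1}"
      show "norm (?p x * conj_fejer N (pi * x)) \<le> 2 * real n / pi * ((x * (1 - x)) ^ l * \<bar>1 - 2 * x\<bar>)"
      proof (cases "x = 0 \<or> x = 1")
        case False
        then have x: "0 < x" "x < 1" using x by auto
        have "norm (?p x * conj_fejer N (pi * x)) \<le> \<bar>?p x\<bar> * (2 * \<bar>cot (pi * x)\<bar>)"
          unfolding real_norm_def abs_mult by (intro mult_left_mono abs_conj_fejer_le s x) simp
        also have "\<dots> = 2 * real n * ((x * (1 - x)) ^ l * \<bar>1 - 2 * x\<bar>) * (x * (1 - x) * \<bar>cot (pi * x)\<bar>)"
          unfolding pderiv_bump l using x by (simp add: abs_mult power_abs mult_ac)
        also have "\<dots> \<le> 2 * real n * ((x * (1 - x)) ^ l * \<bar>1 - 2 * x\<bar>) * (1 / pi)"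
          using x by (intro mult_left_mono cot_upper) auto
        finally show ?thesis by simp
      qed (use p0[of x] x in auto)
    qed
  next
    show "\<forall>x\<in>{0..1}. (\<lambda>N. ?p x * conj_fejer N (pi * x)) \<longlonglongrightarrow> ?p x * cot (pi * x)"
    proof
      fix x :: real assume x: "x \<in> {0..1}"
      show "(\<lambda>N. ?p x * conj_fejer N (pi * x)) \<longlonglongrightarrow> ?p x * cot (pi * x)"
      proof (cases "x = 0 \<or> x = 1")
        case False
        then show ?thesis using x by (intro tendsto_mult_left conj_fejer_tendsto_cot s) auto
      qed (simp add: p0)
    qed
  qed
qed

lemma bump_cot_integral_bounds:
  assumes n: "n = Suc (Suc l)"
    and L: "((\<lambda>x. poly (pderiv ([:0, 1, -1:] ^ n)) x * cot (pi * x)) has_integral L) {0..1}"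
  shows "0 < L" "L \<le> 1 / (pi * 4 ^ l)"
proof -
  let ?p = "poly (pderiv ([:0, 1, -1 :: real:] ^ n))"
  \<comment> \<open>The minorant given by \<open>cot_lower\<close>. It is continuous and
    nonnegative, so a zero integral would force it to vanish identically.\<close>
  define h where "h x = real n * (x * (1 - x)) ^ Suc l * (pi / 2 * (1 - 2 * x)\<^sup>2)" for x
  have h_le: "h x \<le> ?p x * cot (pi * x)" if x: "x \<in> {0..1}" for x
  proof (cases "x = 0 \<or> x = 1")
    case False
    have "h x \<le> real n * (x * (1 - x)) ^ Suc l * ((1 - 2 * x) * cot (pi * x))"
      unfolding h_def using False x by (intro mult_left_mono cot_lower) auto
    then show ?thesis unfolding pderiv_bump n by (simp add: mult_ac)
  qed (auto simp: h_def pderiv_bump n)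
  have h_nonneg: "h x \<ge> 0" if "x \<in> {0..1}" for x
    using that unfolding h_def by auto
  have cont: "continuous_on {0..1} h" unfolding h_def by (intro continuous_intros)
  then have int: "h integrable_on {0..1}" by (rule integrable_continuous_real)
  have "integral {0..1} h \<noteq> 0"
  proof
    assume "integral {0..1} h = 0"
    then have "(h has_integral 0) (cbox 0 1)" using int by (simp add: has_integral_integral)
    \<comment> \<open>The point 1/4 avoids the zeros 0, 1/2 and 1 of \<open>h\<close>.\<close>
    from has_integral_0_cbox_imp_0[OF _ _ this, of "1/4"] cont h_nonneg
    have "h (1/4) = 0" by auto
    then show False by (simp add: h_def n)
  qed
  moreover have "integral {0..1} h \<ge> 0" by (intro integral_nonneg int h_nonneg)
  moreover have "integral {0..1} h \<le> L"
    using has_integral_le[OF integrable_integral[OF int] L] h_le by auto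
  ultimately show "0 < L" by linarith
  have "L \<le> real n / pi * (2 / (real (Suc l) * 4 ^ Suc l))"
  proof (rule has_integral_le[OF L has_integral_mult_right[OF has_integral_power_mult_abs]])
    fix x :: real assume x: "x \<in> {0..1}"
    show "?p x * cot (pi * x) \<le> real n / pi * ((x * (1 - x)) ^ l * \<bar>1 - 2 * x\<bar>)"
    proof (cases "x = 0 \<or> x = 1")
      case False
      have "?p x * cot (pi * x) \<le> \<bar>?p x * cot (pi * x)\<bar>" by simp
      also have "\<dots> = real n * ((x * (1 - x)) ^ l * \<bar>1 - 2 * x\<bar>) * (x * (1 - x) * \<bar>cot (pi * x)\<bar>)"
        unfolding pderiv_bump n using x by (simp add: abs_mult power_abs mult_ac)
      also have "\<dots> \<le> real n * ((x * (1 - x)) ^ l * \<bar>1 - 2 * x\<bar>) * (1 / pi)"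
        using x False by (intro mult_left_mono cot_upper) auto
      finally show ?thesis by simp
    qed (auto simp: pderiv_bump n)
  qed
  also have "\<dots> \<le> 1 / (pi * 4 ^ l)"
  proof -
    \<comment> \<open>After cancellation this is n = l + 2 <= 2 (l + 1).\<close>
    have "real n * 2 * (pi * 4 ^ l) \<le> pi * (real (Suc l) * 4 ^ Suc l)"
      unfolding n by (simp add: algebra_simps)
    then show ?thesis by (simp add: field_simps del: of_nat_Suc power_Suc)
  qed
  finally show "L \<le> 1 / (pi * 4 ^ l)" .
qed

section \<open>Common denominators and the final estimate\<close>

lemma common_denominator_props:
  assumes "finite A" "A \<subseteq> \<rat>"
  shows "common_denominator A > 0" "\<And>x. x \<in> A \<Longrightarrow> real (common_denominator A) * x \<in> \<int>"
proof -
  \<comment> \<open>The \<open>LEAST\<close> is attained once some common denominator exists;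
    multiplying the individual denominators provides one.\<close>
  have "\<exists>q::nat. q > 0 \<and> (\<forall>x\<in>A. real q * x \<in> \<int>)"
    using assms
  proof (induction A)
    case (insert y A)
    then obtain q :: nat where q: "q > 0" "\<And>x. x \<in> A \<Longrightarrow> real q * x \<in> \<int>" by auto
    obtain u v where uv: "v > 0" "y = of_int u / of_int v"
      using insert.prems by (auto elim: Rats_cases')
    have y: "real (nat v) * y \<in> \<int>" using uv by simp
    have qv: "real (q * nat v) * x \<in> \<int>" if "x \<in> insert y A" for x
    proof (cases "x = y")
      case True
      have "real q * (real (nat v) * y) \<in> \<int>" by (rule Ints_mult[OF Ints_of_nat y])
      then show ?thesis unfolding True of_nat_mult mult.assoc .
    next
      case False
      then have "real (nat v) * (real q * x) \<in> \<int>"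
        using that by (intro Ints_mult[OF Ints_of_nat q(2)]) simp
      then show ?thesis by (simp add: mult_ac)
    qed
    have "q * nat v > 0" using q(1) uv(1) by simp
    with qv show ?case by blast
  qed (rule exI[of _ 1], simp)
  then have props: "common_denominator A > 0 \<and> (\<forall>x\<in>A. real (common_denominator A) * x \<in> \<int>)"
    unfolding common_denominator_def
    by (rule LeastI_ex[where P = "\<lambda>q. q > 0 \<and> (\<forall>x\<in>A. real q * x \<in> \<int>)"])
  show "common_denominator A > 0" by (rule conjunct1[OF props])
  show "real (common_denominator A) * x \<in> \<int>" if "x \<in> A" for x
    by (rule bspec[OF conjunct2[OF props] that])
qed

theorem mainTheorem3:
  fixes a :: nat
  assumes "\<forall>k\<in>{a + 1..2 * a + 1}. riemann_zeta (real (2 * k + 1)) / pi ^ (2 * k + 1) \<in> \<rat>"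
  shows "common_denominator
           ((\<lambda>k. riemann_zeta (real (2 * k + 1)) / pi ^ (2 * k + 1)) ` {a + 1..2 * a + 1})
         \<ge> fact (2 * a + 2)"
proof -
  define r where "r k = riemann_zeta (real (2 * k + 1)) / pi ^ (2 * k + 1)" for k
  define q where "q = common_denominator (r ` {a + 1..2 * a + 1})"
  \<comment> \<open>With this n, the condition 2k + 1 \<ge> n means k \<ge> a + 1, and the summation
    range k < n means k <= 2a + 1: exactly the given zeta values occur.\<close>
  define n where "n = 2 * a + 2"
  define D where "D k = poly ((pderiv ^^ (2 * k + 1)) ([:0, 1, -1 :: real:] ^ n)) 0" for k
  define L where "L = (\<Sum>k=a+1..2*a+1. (-1) ^ k * 4 * D k / 2 ^ (2 * k + 1) * r k)"
  have q: "q > 0" "\<And>k. k \<in> {a+1..2*a+1} \<Longrightarrow> real q * r k \<in> \<int>"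
  proof -
    have "r ` {a + 1..2 * a + 1} \<subseteq> \<rat>" using assms unfolding r_def by blast
    note props = common_denominator_props[OF finite_imageI[OF finite_atLeastAtMost] this]
    show "q > 0" unfolding q_def by (rule props(1))
    show "real q * r k \<in> \<int>" if "k \<in> {a+1..2*a+1}" for k
      unfolding q_def by (rule props(2)) (rule imageI[OF that])
  qed
  have "((\<lambda>x. poly (pderiv ([:0, 1, -1:] ^ n)) x * cot (pi * x)) has_integral L) {0..1}"
  proof (rule bump_cot_has_integral[OF _ has_integral_pderiv_bump_sin])
    show "(\<lambda>m. \<Sum>k<n. (-1) ^ k * 4 * poly ((pderiv ^^ (2 * k + 1)) ([:0, 1, -1:] ^ n)) 0
       / (2 * pi * real (Suc m)) ^ (2 * k + 1)) sums L"
    proof -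
      have "(\<lambda>m. \<Sum>k=a+1..2*a+1. (-1) ^ k * 4 * D k / (2 ^ (2 * k + 1) * pi ^ (2 * k + 1)) *
          (1 / real (Suc m) ^ (2 * k + 1))) sums
         (\<Sum>k=a+1..2*a+1. (-1) ^ k * 4 * D k / (2 ^ (2 * k + 1) * pi ^ (2 * k + 1)) *
            riemann_zeta (real (2 * k + 1)))"
        by (intro sums_sum sums_mult riemann_zeta_sums) auto
      moreover have "(\<Sum>k=a+1..2*a+1. (-1) ^ k * 4 * D k / (2 ^ (2 * k + 1) * pi ^ (2 * k + 1)) *
            riemann_zeta (real (2 * k + 1))) = L"
        unfolding L_def r_def by (intro sum.cong refl) simp
      moreover have "(\<Sum>k=a+1..2*a+1. (-1) ^ k * 4 * D k / (2 ^ (2 * k + 1) * pi ^ (2 * k + 1)) *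
          (1 / real (Suc m) ^ (2 * k + 1))) =
         (\<Sum>k<n. (-1) ^ k * 4 * D k / (2 * pi * real (Suc m)) ^ (2 * k + 1))" for m
      proof (rule sum.mono_neutral_cong_left)
        show "\<forall>k\<in>{..<n} - {a + 1..2 * a + 1}.
            (-1) ^ k * 4 * D k / (2 * pi * real (Suc m)) ^ (2 * k + 1) = 0"
        proof
          fix k assume "k \<in> {..<n} - {a + 1..2 * a + 1}"
          then have "D k = 0" unfolding D_def n_def by (intro higher_pderiv_bump_0_eq_0) auto
          then show "(-1) ^ k * 4 * D k / (2 * pi * real (Suc m)) ^ (2 * k + 1) = 0" by simp
        qed
      qed (auto simp: n_def power_mult_distrib)
      ultimately show ?thesis by (simp only: D_def)
    qed
  qed (auto simp: n_def)
  from bump_cot_integral_bounds[OF _ this, of "2 * a"]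
  have L: "0 < L" "L \<le> 1 / (pi * 4 ^ (2 * a))" by (simp_all add: n_def)
  \<comment> \<open>This is the integer to be estimated: q clears the zeta quotients, n! divides the
    derivatives \<open>D k\<close>, and 2^(4a+1) is the largest denominator 2^(2k+1) / 4, reached at
    k = 2a + 1.\<close>
  define Z where "Z = real q * (2 ^ (4 * a + 1) * L / fact n)"
  have "Z = (\<Sum>k=a+1..2*a+1. (-1) ^ k * (D k / fact n) * 2 ^ (2 * (2 * a + 1 - k)) * (real q * r k))"
    unfolding Z_def L_def sum_distrib_left sum_divide_distrib
  proof (intro sum.cong refl)
    fix k assume k: "k \<in> {a + 1..2 * a + 1}"
    have "(2::real) ^ (4 * a + 1) * 4 = 2 ^ (4 * a + 3)" by (simp add: power_add)
    also have "4 * a + 3 = 2 * (2 * a + 1 - k) + (2 * k + 1)" using k by auto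
    finally have *: "(2::real) ^ (4 * a + 1) * 4 = 2 ^ (2 * (2 * a + 1 - k)) * 2 ^ (2 * k + 1)"
      by (simp only: power_add)
    have "real q * (2 ^ (4 * a + 1) * ((-1) ^ k * 4 * D k / 2 ^ (2 * k + 1) * r k) / fact n)
        = (2 ^ (4 * a + 1) * 4) / 2 ^ (2 * k + 1) * ((-1) ^ k * (D k / fact n) * (real q * r k))"
      by simp
    also have "\<dots> = (-1) ^ k * (D k / fact n) * 2 ^ (2 * (2 * a + 1 - k)) * (real q * r k)"
      unfolding * by simp
    finally show "real q * (2 ^ (4 * a + 1) * ((-1) ^ k * 4 * D k / 2 ^ (2 * k + 1) * r k) / fact n)
        = (-1) ^ k * (D k / fact n) * 2 ^ (2 * (2 * a + 1 - k)) * (real q * r k)" .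
  qed
  also have "\<dots> \<in> \<int>"
    unfolding D_def by (intro Ints_sum Ints_mult higher_pderiv_bump_0 q Ints_power) auto
  finally have "Z \<in> \<int>" .
  moreover have "Z > 0" using L q by (simp add: Z_def)
  ultimately have "Z \<ge> 1" by (auto elim!: Ints_cases)
  \<comment> \<open>The bound 4^(-2a) / pi on the integral absorbs the power of 2 used to clear
    denominators, leaving 2/pi.\<close>
  moreover have "2 ^ (4 * a + 1) * L \<le> 1"
  proof -
    have "(2::real) ^ (4 * a + 1) = 2 * 4 ^ (2 * a)"
      by (simp add: power_add power_mult)
    then have "2 ^ (4 * a + 1) * L \<le> 2 * 4 ^ (2 * a) * (1 / (pi * 4 ^ (2 * a)))"
      using L by (simp only: mult_left_mono mult_nonneg_nonneg zero_le_power zero_le_numeral)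
    also have "\<dots> = 2 / pi" by simp
    also have "\<dots> \<le> 1" using pi_ge_two by simp
    finally show ?thesis .
  qed
  then have "Z \<le> real q / fact n"
    unfolding Z_def using mult_left_mono[of "2 ^ (4 * a + 1) * L" 1 "real q / fact n"] by simp
  ultimately have "1 \<le> real q / fact n" by linarith
  then have "real (fact n) \<le> real q" by (simp add: field_simps)
  then have "fact n \<le> q" by (simp only: of_nat_le_iff)
  then show ?thesis unfolding q_def r_def n_def .
qed

end
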